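(* Let $D,D'$ be Prüfer domains whose spectra $\operatorname{Spec}(D)$ and $\operatorname{Spec}(D')$ are homeomorphic. Then $D$ is completely integrally closed if and only if $D'$ is completely integrally closed.
   Context: A Prüfer domain is an integral domain $D$ such that $D_P$ is a valuation domain for every $P\in\operatorname{Spec}(D)$. For an integral domain $D$ with quotient field $K$, an element $z\in K$ is almost integral over $D$ if there is a nonzero $c\in D$ such that $cz^n\in D$ for every positive integer $n$; the complete integral closure $D^\ast$ of $D$ is the ring of all elements of $K$ that are almost integral over $D$, and $D$ is completely integrally closed if $D=D^\ast$. Spectra are endowed with the Zariski topology. *)

theory Defs
  imports
    "HOL-Analysis.Abstract_Topology"
    "HOL-Computational_Algebra.Polynomial_Factorial"
    "HOL-Algebra.Algebraic_Closure_Type"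
begin

text \<open>
  An integral domain \<open>D\<close> is a type \<open>'a\<close> of class \<^class>\<open>idom\<close>; its quotient field is \<open>'a fract\<close>,
  into which \<open>D\<close> is embedded by \<open>to_fract\<close>.
\<close>

section \<open>The prime spectrum and the Zariski topology\<close>

definition prime_ideal :: "'a::comm_ring_1 set \<Rightarrow> bool" where
  "prime_ideal P \<longleftrightarrow>
     0 \<in> P \<and> (\<forall>x\<in>P. \<forall>y\<in>P. x + y \<in> P) \<and> (\<forall>r. \<forall>x\<in>P. r * x \<in> P) \<and>
     P \<noteq> UNIV \<and> (\<forall>x y. x * y \<in> P \<longrightarrow> x \<in> P \<or> y \<in> P)"

lemma prime_ideal_iff_primeideal:
  "prime_ideal P \<longleftrightarrow> primeideal P (ring_of_type_algebra :: 'a::comm_ring_1 ring)"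
  (is "_ \<longleftrightarrow> primeideal P ?R")
proof
  interpret R: cring ?R by (rule cring_from_type_algebra)
  have R_sel [simp]: "carrier ?R = UNIV" "monoid.mult ?R = (*)" "monoid.one ?R = 1" "ring.zero ?R = 0" "ring.add ?R = (+)"
    by (auto simp: ring_of_type_algebra_def fun_eq_iff)
  {
    assume P: "prime_ideal P"
    have mult: "r * x \<in> P" if "x \<in> P" for r x
      using P that unfolding prime_ideal_def by blast
    have a_inv: "a_inv ?R x = - x" for x :: 'a
      using R.minus_equality[of "- x" x] by simp
    have neg: "- x \<in> P" if "x \<in> P" for x
    proof -
      have "(-1) * x \<in> P" using that by (rule mult)
      then show ?thesis by simp
    qed
    have "subgroup P (add_monoid ?R)"
      using P by (intro R.add.subgroupI) (auto simp: prime_ideal_def a_inv neg)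
    then have "ideal P ?R"
      using mult by (intro idealI R.ring_axioms) (simp_all add: mult.commute)
    then show "primeideal P ?R"
      using P by (intro primeidealI R.is_cring) (auto simp: prime_ideal_def)
  next
    assume "primeideal P ?R"
    then interpret P: primeideal P ?R .
    show "prime_ideal P"
      unfolding prime_ideal_def
      using P.zero_closed P.a_closed P.I_l_closed P.I_notcarr P.I_prime
      by auto
  }
qed

definition spectrum :: "'a::comm_ring_1 set set" where
  "spectrum = {P. prime_ideal P}"

definition zariski_topology :: "'a::comm_ring_1 set topology" where
  "zariski_topology = topology (\<lambda>U. \<exists>E. U = {P \<in> spectrum. \<not> E \<subseteq> P})"

lemma openin_zariski_topology:
  "openin (zariski_topology :: 'a::comm_ring_1 set topology) U \<longleftrightarrow>
     (\<exists>E. U = {P \<in> spectrum. \<not> E \<subseteq> P})"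
proof -
  let ?O = "\<lambda>U. \<exists>E :: 'a set. U = {P \<in> spectrum. \<not> E \<subseteq> P}"
  have "?O (S \<inter> T)" if S: "?O S" and T: "?O T" for S T
  proof -
    from S T obtain E F :: "'a set"
      where E: "S = {P \<in> spectrum. \<not> E \<subseteq> P}" and F: "T = {P \<in> spectrum. \<not> F \<subseteq> P}"
      by blast
    have *: "{e * f | e f. e \<in> E \<and> f \<in> F} \<subseteq> P \<longleftrightarrow> E \<subseteq> P \<or> F \<subseteq> P" if "P \<in> spectrum" for P
    proof
      assume A: "{e * f | e f. e \<in> E \<and> f \<in> F} \<subseteq> P"
      show "E \<subseteq> P \<or> F \<subseteq> P"
      proof (rule ccontr)
        assume "\<not> (E \<subseteq> P \<or> F \<subseteq> P)"
        then obtain e f where ef: "e \<in> E" "e \<notin> P" "f \<in> F" "f \<notin> P" by blast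
        then have "e * f \<in> P" using A by blast
        with ef that show False by (auto simp: spectrum_def prime_ideal_def)
      qed
    next
      assume A: "E \<subseteq> P \<or> F \<subseteq> P"
      have "r * x \<in> P" "x * r \<in> P" if "x \<in> P" for r x
        using that \<open>P \<in> spectrum\<close>
        by (auto simp: spectrum_def prime_ideal_def mult.commute[of x])
      with A show "{e * f | e f. e \<in> E \<and> f \<in> F} \<subseteq> P"
        by blast
    qed
    have "S \<inter> T = {P \<in> spectrum. \<not> E \<subseteq> P \<and> \<not> F \<subseteq> P}"
      unfolding E F by (intro Set.set_eqI) (simp, argo)
    also have "\<dots> = {P \<in> spectrum. \<not> {e * f | e f. e \<in> E \<and> f \<in> F} \<subseteq> P}"
      by (intro Collect_cong conj_cong refl) (simp only: * de_Morgan_disj)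
    finally show ?thesis by (rule exI)
  qed
  moreover have "?O (\<Union>\<K>)" if "\<forall>K\<in>\<K>. ?O K" for \<K>
  proof -
    from that obtain E where E: "\<And>K. K \<in> \<K> \<Longrightarrow> K = {P \<in> spectrum. \<not> E K \<subseteq> P}"
      by metis
    have "P \<in> \<Union>\<K> \<longleftrightarrow> P \<in> spectrum \<and> (\<exists>K\<in>\<K>. \<not> E K \<subseteq> P)" for P
    proof -
      have "P \<in> K \<longleftrightarrow> P \<in> spectrum \<and> \<not> E K \<subseteq> P" if "K \<in> \<K>" for K
        by (subst E[OF that]) simp
      then show ?thesis by (metis UnionE UnionI)
    qed
    then have "\<Union>\<K> = {P \<in> spectrum. \<not> (\<Union>K\<in>\<K>. E K) \<subseteq> P}"
      by (intro Set.set_eqI) (simp only: mem_Collect_eq UN_subset_iff, blast)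
    then show ?thesis by (rule exI)
  qed
  ultimately have "istopology ?O"
    unfolding istopology_def by (intro conjI allI impI)
  then show ?thesis
    by (simp add: zariski_topology_def topology_inverse')
qed

lemma topspace_zariski_topology: "topspace zariski_topology = spectrum"
proof
  show "topspace zariski_topology \<subseteq> spectrum"
    by (auto simp: topspace_def openin_zariski_topology)
  have "spectrum = {P \<in> spectrum. \<not> UNIV \<subseteq> P}"
    by (auto simp: spectrum_def prime_ideal_def)
  then have "openin zariski_topology spectrum"
    by (auto simp: openin_zariski_topology)
  then show "spectrum \<subseteq> topspace zariski_topology"
    by (rule openin_subset)
qed

section \<open>Pruefer domains\<close>

text \<open>The localization \<open>D\<^sub>P\<close> at a prime ideal \<open>P\<close>, as a subring of the quotient field.\<close>

definition localization :: "'a::idom set \<Rightarrow> 'a fract set" where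
  "localization P = {Fract a s | a s. s \<notin> P}"

text \<open>
  Valuation domains inside a field. Every element of the field is an element of \<open>V\<close> or the
  inverse of one, so the field is automatically the quotient field of \<open>V\<close>. In Isabelle/HOL
  \<open>inverse 0 = 0\<close>, so the case \<open>x = 0\<close> is harmless.
\<close>

definition valuation_domain :: "'k::field set \<Rightarrow> bool" where
  "valuation_domain V \<longleftrightarrow>
     1 \<in> V \<and> (\<forall>x\<in>V. \<forall>y\<in>V. x - y \<in> V \<and> x * y \<in> V) \<and> (\<forall>x. x \<in> V \<or> inverse x \<in> V)"

definition prufer_domain :: "'a::idom itself \<Rightarrow> bool" where
  "prufer_domain TYPE('a) \<longleftrightarrow> (\<forall>P \<in> (spectrum :: 'a set set). valuation_domain (localization P))"

section \<open>Complete integral closure\<close>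

definition almost_integral :: "'a::idom fract \<Rightarrow> bool" where
  "almost_integral z \<longleftrightarrow>
     (\<exists>c::'a. c \<noteq> 0 \<and> (\<forall>n\<ge>1. to_fract c * z ^ n \<in> range to_fract))"

definition complete_integral_closure :: "'a::idom fract set" where
  "complete_integral_closure = {z. almost_integral z}"

definition completely_integrally_closed :: "'a::idom itself \<Rightarrow> bool" where
  "completely_integrally_closed TYPE('a) \<longleftrightarrow>
     range to_fract = (complete_integral_closure :: 'a fract set)"

end

theory Submission
  imports Defs
begin

text \<open>
  A Pruefer domain fails to be completely integrally closed iff there are a proper quasi-compact
  open set \<open>U\<close> and a proper closed set \<open>C\<close> of the spectrum such that every point outside \<open>U\<close> is a
  specialization of a point of \<open>U \<inter> C\<close>; this is a purely topological condition.

  If \<open>z \<notin> D\<close> and \<open>c z\<^sup>n \<in> D\<close> for all \<open>n\<close>, take \<open>U = {P. z \<in> D\<^sub>P}\<close>, which is quasi-compact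
  because \<open>1\<close> is the sum of a denominator of \<open>z\<close> and one of \<open>1/z\<close>, and \<open>C = V(c)\<close>. For \<open>z \<notin> D\<^sub>M\<close>
  the ideal \<open>{d. \<forall>n. d z\<^sup>n \<in> D\<^sub>M}\<close> is the required prime below \<open>M\<close>.

  Conversely, let \<open>U\<close> be the complement of \<open>V(T)\<close> with \<open>T\<close> finite, \<open>C \<subseteq> V(c)\<close> with \<open>c \<noteq> 0\<close>, and
  \<open>T \<subseteq> M\<close>. As \<open>T\<close> generates a principal ideal of \<open>D\<^sub>M\<close>, some \<open>z \<notin> D\<close> satisfies \<open>z T \<subseteq> D\<close>.
  Then \<open>c z\<^sup>n\<close> lies in every \<open>D\<^sub>N\<close>: either \<open>T\<close> is not contained in \<open>N\<close> and \<open>z \<in> D\<^sub>N\<close>, or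
  there is a prime \<open>Q \<subseteq> N\<close> with \<open>c \<in> Q\<close> and \<open>z \<in> D\<^sub>Q\<close>, so that \<open>c z\<^sup>n \<in> Q D\<^sub>Q \<subseteq> D\<^sub>N\<close>.
\<close>

text \<open>Viewing the ring as a module over itself makes \<open>ring_ideal.subspace\<close> mean
  "ideal" and \<open>ring_ideal.span\<close> mean "generated ideal".\<close>

interpretation ring_ideal: Modules.module "(*) :: 'a::comm_ring_1 \<Rightarrow> 'a \<Rightarrow> 'a"
  by unfold_locales (simp_all add: algebra_simps)

text \<open>Over the ring itself this rule reverses associativity, and \<open>algebra_simps\<close> would loop.\<close>
declare ring_ideal.scale_scale [simp del]

section \<open>Prime ideals\<close>

lemma prime_idealD:
  assumes "P \<in> spectrum"
  shows "0 \<in> P" "1 \<notin> P" "x \<in> P \<Longrightarrow> y \<in> P \<Longrightarrow> x + y \<in> P" "x \<in> P \<Longrightarrow> r * x \<in> P"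
    "x \<in> P \<Longrightarrow> x * r \<in> P" "x * y \<in> P \<longleftrightarrow> x \<in> P \<or> y \<in> P"
proof -
  have *: "prime_ideal P" using assms by (simp add: spectrum_def)
  then show "0 \<in> P" "x \<in> P \<Longrightarrow> y \<in> P \<Longrightarrow> x + y \<in> P"
    by (auto simp: prime_ideal_def)
  show m: "r * x \<in> P" if "x \<in> P" for r x using that * by (auto simp: prime_ideal_def)
  show m': "x * r \<in> P" if "x \<in> P" for r x using m[OF that, of r] by (simp add: mult.commute)
  show "1 \<notin> P"
  proof
    assume "1 \<in> P"
    then have "x \<in> P" for x using m[of 1 x] by simp
    with * show False by (auto simp: prime_ideal_def)
  qed
  show "x * y \<in> P \<longleftrightarrow> x \<in> P \<or> y \<in> P"
  proof
    assume "x * y \<in> P"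
    then show "x \<in> P \<or> y \<in> P" using * unfolding prime_ideal_def by (elim conjE) simp
  qed (use m m' in auto)
qed

lemma spectrum_subspace: "P \<in> spectrum \<Longrightarrow> ring_ideal.subspace P"
  by (auto simp: ring_ideal.subspace_def prime_idealD)

lemma zero_in_spectrum: "{0} \<in> (spectrum :: 'a::idom set set)"
proof -
  have "(1 :: 'a) \<notin> {0}" by simp
  then have "{0} \<noteq> (UNIV :: 'a set)" by blast
  then show ?thesis by (simp add: spectrum_def prime_ideal_def)
qed

lemma spectrum_power_notin: "P \<in> spectrum \<Longrightarrow> a \<notin> P \<Longrightarrow> a ^ n \<notin> P"
  by (induction n) (auto simp: prime_idealD)

text \<open>Krull's argument: Zorn's lemma gives an ideal maximal among those containing
  \<open>I\<close> and disjoint from the multiplicative set \<open>S\<close>, and such an ideal is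
  prime.\<close>

lemma prime_ideal_avoiding:
  fixes I S :: "'a::comm_ring_1 set"
  assumes I: "ring_ideal.subspace I" and S: "1 \<in> S" "\<And>x y. x \<in> S \<Longrightarrow> y \<in> S \<Longrightarrow> x * y \<in> S"
    and disj: "I \<inter> S = {}"
  obtains P where "P \<in> spectrum" "I \<subseteq> P" "P \<inter> S = {}"
proof -
  let ?A = "{J. ring_ideal.subspace J \<and> I \<subseteq> J \<and> J \<inter> S = {}}"
  have "\<exists>M\<in>?A. \<forall>J\<in>?A. M \<subseteq> J \<longrightarrow> J = M"
  proof (rule subset_Zorn_nonempty)
    show "?A \<noteq> {}" using I disj by blast
  next
    fix \<C> assume ne: "\<C> \<noteq> {}" and ch: "subset.chain ?A \<C>"
    have sub: "ring_ideal.subspace J" "I \<subseteq> J" "J \<inter> S = {}" if "J \<in> \<C>" for J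
      using that ch unfolding subset_chain_def by blast+
    have "ring_ideal.subspace (\<Union>\<C>)"
    proof (rule ring_ideal.subspaceI)
      obtain J where J: "J \<in> \<C>" using ne by blast
      then show "0 \<in> \<Union>\<C>" using ring_ideal.subspace_0[OF sub(1)[OF J]] by blast
    next
      fix x y assume "x \<in> \<Union>\<C>" "y \<in> \<Union>\<C>"
      then obtain J K where "J \<in> \<C>" "x \<in> J" "K \<in> \<C>" "y \<in> K" by blast
      moreover from this have "J \<subseteq> K \<or> K \<subseteq> J" using ch unfolding subset_chain_def by blast
      ultimately obtain L where L: "L \<in> \<C>" "x \<in> L" "y \<in> L" by blast
      then show "x + y \<in> \<Union>\<C>" using ring_ideal.subspace_add[OF sub(1)[OF L(1)]] by blast
    next
      fix c x assume "x \<in> \<Union>\<C>"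
      then obtain J where J: "J \<in> \<C>" "x \<in> J" by blast
      then show "c * x \<in> \<Union>\<C>" using ring_ideal.subspace_scale[OF sub(1)[OF J(1)]] by blast
    qed
    moreover obtain J where "J \<in> \<C>" using ne by blast
    then have "I \<subseteq> \<Union>\<C>" using sub(2) by blast
    moreover have "\<Union>\<C> \<inter> S = {}" by (simp add: Int_Union2 sub(3))
    ultimately show "\<Union>\<C> \<in> ?A" by simp
  qed
  then obtain M where "M \<in> ?A" and max: "\<forall>J\<in>?A. M \<subseteq> J \<longrightarrow> J = M" by (rule bexE)
  then have M: "ring_ideal.subspace M" "I \<subseteq> M" "M \<inter> S = {}" by simp_all
  \<comment> \<open>By maximality, adjoining any \<open>x\<close> outside \<open>M\<close> produces
    an ideal that meets \<open>S\<close>.\<close>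
  have meets: "\<exists>k. \<exists>s\<in>S. s - k * x \<in> M" if "x \<notin> M" for x
  proof (rule ccontr)
    assume no: "\<not> ?thesis"
    have span_M: "ring_ideal.span M = M" using M(1) by (simp add: ring_ideal.span_eq_iff)
    have "ring_ideal.span (insert x M) \<inter> S = {}"
      using no by (auto simp: ring_ideal.span_breakdown_eq span_M)
    moreover have *: "insert x M \<subseteq> ring_ideal.span (insert x M)"
      by (rule ring_ideal.span_superset)
    then have "I \<subseteq> ring_ideal.span (insert x M)" "M \<subseteq> ring_ideal.span (insert x M)"
      using M(2) by auto
    ultimately have "ring_ideal.span (insert x M) = M"
      using max[rule_format, of "ring_ideal.span (insert x M)"] by simp
    with that * show False by simp
  qed
  have "prime_ideal M"
    unfolding prime_ideal_def
  proof (intro conjI allI ballI impI)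
    show "0 \<in> M" using M(1) by (rule ring_ideal.subspace_0)
    show "x + y \<in> M" if "x \<in> M" "y \<in> M" for x y
      using M(1) that by (rule ring_ideal.subspace_add)
    show scale: "r * x \<in> M" if "x \<in> M" for r x
      using M(1) that by (rule ring_ideal.subspace_scale)
    show "M \<noteq> UNIV" using M(3) S(1) by blast
    fix x y assume xy: "x * y \<in> M"
    show "x \<in> M \<or> y \<in> M"
    proof (rule ccontr)
      assume "\<not> (x \<in> M \<or> y \<in> M)"
      then obtain k l s t where *: "s \<in> S" "s - k * x \<in> M" "t \<in> S" "t - l * y \<in> M"
        using meets[of x] meets[of y] by auto
      \<comment> \<open>The mixed terms cancel and the sum is \<open>s * t\<close>, which lies in
        \<open>S\<close>.\<close>
      have "t * (s - k * x) + (k * x * (t - l * y) + k * l * (x * y)) \<in> M"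
        by (intro ring_ideal.subspace_add[OF M(1)] scale * xy)
      then have "s * t \<in> M" by (simp add: algebra_simps)
      then show False using M(3) S(2) * by blast
    qed
  qed
  then show thesis using that[of M] M by (simp add: spectrum_def)
qed

corollary prime_ideal_containing:
  assumes "ring_ideal.subspace I" "1 \<notin> I"
  obtains P where "P \<in> spectrum" "I \<subseteq> P"
  using prime_ideal_avoiding[of I "{1}"] assms by auto

section \<open>The Zariski topology\<close>

lemma openin_zariski: "openin zariski_topology {P \<in> spectrum. \<not> E \<subseteq> P}"
  by (auto simp: openin_zariski_topology)

text \<open>This recovers the inclusion order of primes from the topology alone, so that conditions
  on chains of primes can be carried along homeomorphisms.\<close>

lemma closure_of_zariski_singleton:
  assumes "P \<in> spectrum" "Q \<in> spectrum"
  shows "P \<in> zariski_topology closure_of {Q} \<longleftrightarrow> Q \<subseteq> P"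
proof
  assume *: "P \<in> zariski_topology closure_of {Q}"
  show "Q \<subseteq> P"
  proof (rule ccontr)
    assume "\<not> Q \<subseteq> P"
    then have "\<exists>y. y \<in> {Q} \<and> y \<in> {P \<in> spectrum. \<not> Q \<subseteq> P}"
      using *[unfolded in_closure_of, THEN conjunct2, rule_format, of "{P \<in> spectrum. \<not> Q \<subseteq> P}"]
        openin_zariski[of Q] assms(1) by simp
    then show False by simp
  qed
next
  assume "Q \<subseteq> P"
  then show "P \<in> zariski_topology closure_of {Q}"
    using assms by (auto simp: in_closure_of topspace_zariski_topology openin_zariski_topology)
qed

text \<open>A cover of this set forces a power of \<open>a\<close> into the ideal generated by all
  the sets \<open>E U\<close>. That power is a combination of finitely many generators, and the
  members of the cover supplying them already suffice.\<close>

lemma compactin_zariski_basic: "compactin zariski_topology {P \<in> spectrum. a \<notin> P}"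
  unfolding compactin_def
proof (intro conjI allI impI)
  show "{P \<in> spectrum. a \<notin> P} \<subseteq> topspace zariski_topology"
    by (auto simp: topspace_zariski_topology)
  fix \<U> assume *: "(\<forall>U\<in>\<U>. openin zariski_topology U) \<and> {P \<in> spectrum. a \<notin> P} \<subseteq> \<Union> \<U>"
  then obtain E where E: "\<And>U. U \<in> \<U> \<Longrightarrow> U = {P \<in> spectrum. \<not> E U \<subseteq> P}"
    unfolding openin_zariski_topology by metis
  let ?I = "ring_ideal.span (\<Union>U\<in>\<U>. E U)"
  \<comment> \<open>Otherwise a prime containing \<open>?I\<close> and avoiding the powers of
    \<open>a\<close> would be a point missed by the cover.\<close>
  have "\<exists>n. a ^ n \<in> ?I"
  proof (rule ccontr)
    assume "\<nexists>n. a ^ n \<in> ?I"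
    then have "?I \<inter> range ((^) a) = {}" by auto
    moreover have "1 \<in> range ((^) a)" by (metis power_0 rangeI)
    moreover have "x * y \<in> range ((^) a)" if "x \<in> range ((^) a)" "y \<in> range ((^) a)" for x y
      using that by (auto simp flip: power_add)
    ultimately obtain P where P: "P \<in> spectrum" "?I \<subseteq> P" "P \<inter> range ((^) a) = {}"
      using prime_ideal_avoiding[OF ring_ideal.subspace_span] by metis
    then have "a \<notin> P" by (metis disjoint_iff power_one_right rangeI)
    with P(1) * obtain U where U: "U \<in> \<U>" "P \<in> U" by blast
    then have "\<not> E U \<subseteq> P" using E by blast
    moreover have "E U \<subseteq> ?I" using U(1) ring_ideal.span_superset by fast
    ultimately show False using P(2) by blast
  qed
  then obtain n t r where t: "finite t" "t \<subseteq> (\<Union>U\<in>\<U>. E U)" "a ^ n = (\<Sum>x\<in>t. r x * x)"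
    unfolding ring_ideal.span_explicit by auto
  have "\<forall>x\<in>t. \<exists>U. U \<in> \<U> \<and> x \<in> E U" using t(2) by blast
  then obtain g where g: "\<forall>x\<in>t. g x \<in> \<U> \<and> x \<in> E (g x)" using bchoice by metis
  define \<F> where "\<F> = g ` t"
  have \<F>: "finite \<F>" "\<F> \<subseteq> \<U>" "t \<subseteq> (\<Union>U\<in>\<F>. E U)"
    using t(1) g by (auto simp: \<F>_def)
  have "{P \<in> spectrum. a \<notin> P} \<subseteq> \<Union>\<F>"
  proof safe
    fix P assume P: "P \<in> spectrum" "a \<notin> P"
    have "\<not> t \<subseteq> P"
    proof
      assume "t \<subseteq> P"
      then have "(\<Sum>x\<in>t. r x * x) \<in> P"
        using P(1) by (intro ring_ideal.subspace_sum spectrum_subspace prime_idealD(4)) auto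
      then show False using spectrum_power_notin[OF P] t(3) by metis
    qed
    then obtain U where "U \<in> \<F>" "\<not> E U \<subseteq> P" using \<F>(3) by blast
    then show "P \<in> \<Union>\<F>" using E[of U] \<F>(2) P(1) by blast
  qed
  then show "\<exists>\<F>. finite \<F> \<and> \<F> \<subseteq> \<U> \<and> {P \<in> spectrum. a \<notin> P} \<subseteq> \<Union>\<F>"
    using \<F> by blast
qed

lemma compact_openin_zariskiE:
  assumes "openin zariski_topology U" "compactin zariski_topology U"
  obtains T where "finite T" "U = {P \<in> spectrum. \<not> T \<subseteq> P}"
proof -
  obtain E where E: "U = {P \<in> spectrum. \<not> E \<subseteq> P}"
    using assms(1) by (auto simp: openin_zariski_topology)
  let ?D = "\<lambda>a. {P \<in> spectrum. \<not> {a} \<subseteq> P}"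
  have "U \<subseteq> \<Union>(?D ` E)" by (auto simp: E)
  moreover have "openin zariski_topology V" if "V \<in> ?D ` E" for V
    using that openin_zariski by blast
  ultimately obtain \<F> where \<F>: "finite \<F>" "\<F> \<subseteq> ?D ` E" "U \<subseteq> \<Union>\<F>"
    using assms(2) unfolding compactin_def by meson
  from finite_subset_image[OF \<F>(1,2)] obtain T where "T \<subseteq> E" "finite T" "\<F> = ?D ` T" by blast
  with \<F>(3) have T: "finite T" "T \<subseteq> E" "U \<subseteq> \<Union>(?D ` T)" by simp_all
  then have "U = {P \<in> spectrum. \<not> T \<subseteq> P}"
    by (auto simp: E)
  with T(1) show thesis by (rule that)
qed

section \<open>Localizations and denominator ideals\<close>

lemma to_fract_power: "to_fract (x ^ n) = to_fract x ^ n"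
  by (induction n) simp_all

text \<open>The conductor ideal (D : x), taken inside D rather than K so that it can be compared
  with primes.\<close>

definition denominators :: "'a::idom fract \<Rightarrow> 'a set" where
  "denominators x = {d. to_fract d * x \<in> range to_fract}"

lemma denominatorsE:
  assumes "d \<in> denominators x"
  obtains e where "to_fract d * x = to_fract e"
  using assms by (auto simp: denominators_def)

lemma denominators_subspace: "ring_ideal.subspace (denominators x)"
proof (rule ring_ideal.subspaceI)
  have "to_fract 0 * x = to_fract 0" by simp
  then show "0 \<in> denominators x" unfolding denominators_def by blast
next
  fix c d assume "c \<in> denominators x" "d \<in> denominators x"
  then obtain a b where "to_fract c * x = to_fract a" "to_fract d * x = to_fract b"
    by (elim denominatorsE)
  then have "to_fract (c + d) * x = to_fract (a + b)" by (simp add: distrib_right)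
  then show "c + d \<in> denominators x" unfolding denominators_def by blast
next
  fix r d assume "d \<in> denominators x"
  then obtain b where "to_fract d * x = to_fract b" by (rule denominatorsE)
  then have "to_fract (r * d) * x = to_fract (r * b)" by (simp add: mult.assoc)
  then show "r * d \<in> denominators x" unfolding denominators_def by blast
qed

lemma localization_iff_denominators:
  assumes "P \<in> spectrum"
  shows "x \<in> localization P \<longleftrightarrow> \<not> denominators x \<subseteq> P"
proof
  assume "x \<in> localization P"
  then obtain a s where *: "x = Fract a s" "s \<notin> P" by (auto simp: localization_def)
  then have "s \<noteq> 0" using assms prime_idealD(1) by metis
  then have "to_fract s * x = to_fract a" by (simp add: * Fract_conv_to_fract)
  then show "\<not> denominators x \<subseteq> P" using * by (auto simp: denominators_def)
next
  assume "\<not> denominators x \<subseteq> P"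
  then obtain s a where *: "s \<notin> P" "to_fract s * x = to_fract a"
    by (auto simp: denominators_def)
  then have "s \<noteq> 0" using assms prime_idealD(1) by metis
  then have "x = Fract a s" by (simp add: Fract_conv_to_fract flip: *(2))
  then show "x \<in> localization P" using * by (auto simp: localization_def)
qed

lemma localizationE:
  assumes "P \<in> spectrum" "x \<in> localization P"
  obtains a s where "s \<notin> P" "to_fract s * x = to_fract a"
  using assms localization_iff_denominators by (metis denominatorsE subsetI)

lemma localizationI:
  assumes "P \<in> spectrum" "s \<notin> P" "to_fract s * x = to_fract a"
  shows "x \<in> localization P"
proof -
  have "s \<in> denominators x" using assms(3) by (simp add: denominators_def)
  then show ?thesis using assms(2) by (auto simp: localization_iff_denominators[OF assms(1)])
qed

lemma to_fract_in_localization: "P \<in> spectrum \<Longrightarrow> to_fract a \<in> localization P"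
  by (rule localizationI[of _ 1 _ a]) (auto simp: prime_idealD)

text \<open>D is the intersection of its localizations: a conductor ideal contained in no prime
  contains 1.\<close>

lemma in_range_to_fract_if_locally:
  assumes "\<And>P. P \<in> spectrum \<Longrightarrow> x \<in> localization P"
  shows "x \<in> range to_fract"
proof -
  have "1 \<in> denominators x"
    using prime_ideal_containing[OF denominators_subspace] assms localization_iff_denominators
    by metis
  then show ?thesis by (simp add: denominators_def)
qed

lemma common_denominator:
  assumes P: "P \<in> spectrum" and "finite A" "A \<subseteq> localization P"
  obtains s where "s \<notin> P" "\<And>x. x \<in> A \<Longrightarrow> to_fract s * x \<in> range to_fract"
proof -
  have "\<exists>s. s \<notin> P \<and> (\<forall>x\<in>A. to_fract s * x \<in> range to_fract)"
    using assms(2,3)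
  proof induction
    case empty
    then show ?case using prime_idealD(2)[OF P] by auto
  next
    case (insert x A)
    then obtain s where s: "s \<notin> P" "\<And>x. x \<in> A \<Longrightarrow> to_fract s * x \<in> range to_fract" by auto
    obtain t a where t: "t \<notin> P" "to_fract t * x = to_fract a"
      using localizationE[OF P, of x] insert.prems by blast
    have "to_fract (s * t) * y \<in> range to_fract" if "y \<in> insert x A" for y
    proof (cases "y = x")
      case True
      then have "to_fract (s * t) * y = to_fract (s * a)" using t by (simp add: mult.assoc)
      then show ?thesis by blast
    next
      case False
      with that s(2) obtain b where "to_fract s * y = to_fract b" by blast
      then have "to_fract (s * t) * y = to_fract (t * b)" by (simp add: mult_ac)
      then show ?thesis by blast
    qed
    moreover have "s * t \<notin> P" using s t P by (simp add: prime_idealD)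
    ultimately show ?case by blast
  qed
  then show thesis using that by blast
qed

section \<open>Valuation domains inside a field\<close>

lemma valuation_domainD:
  assumes "valuation_domain V"
  shows "1 \<in> V" "0 \<in> V" "x \<in> V \<Longrightarrow> y \<in> V \<Longrightarrow> x + y \<in> V" "x \<in> V \<Longrightarrow> y \<in> V \<Longrightarrow> x * y \<in> V"
    "x \<notin> V \<Longrightarrow> inverse x \<in> V" "x \<in> V \<Longrightarrow> x ^ n \<in> V"
proof -
  have minus: "x - y \<in> V" if "x \<in> V" "y \<in> V" for x y
    using assms that by (auto simp: valuation_domain_def)
  show one: "1 \<in> V" using assms by (auto simp: valuation_domain_def)
  show zero: "0 \<in> V" using minus[OF one one] by simp
  show "x + y \<in> V" if "x \<in> V" "y \<in> V"
    using minus[OF that(1) minus[OF zero that(2)]] by simp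
  show mult: "x * y \<in> V" if "x \<in> V" "y \<in> V" for x y
    using assms that by (auto simp: valuation_domain_def)
  show "x \<notin> V \<Longrightarrow> inverse x \<in> V" using assms by (auto simp: valuation_domain_def)
  show "x \<in> V \<Longrightarrow> x ^ n \<in> V" by (induction n) (auto simp: one mult)
qed

text \<open>Divisibility is a total preorder, so a finite set has an element of least value; it
  generates the same V-submodule of the field as the whole set.\<close>

lemma valuation_domain_principal:
  assumes V: "valuation_domain V" and "finite A" "A \<noteq> {}" "0 \<notin> A"
  obtains a where "a \<in> A" "\<And>b. b \<in> A \<Longrightarrow> b / a \<in> V"
proof -
  have "\<exists>a\<in>A. \<forall>b\<in>A. b / a \<in> V"
    using assms(2-)
  proof (induction rule: finite_ne_induct)
    case (singleton x)
    then show ?case using valuation_domainD(1)[OF V] by simp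
  next
    case (insert x A)
    then obtain a where a: "a \<in> A" "\<And>b. b \<in> A \<Longrightarrow> b / a \<in> V" by auto
    then have nz: "a \<noteq> 0" "x \<noteq> 0" using insert.prems by auto
    show ?case
    proof (cases "x / a \<in> V")
      case True
      then show ?thesis using a by blast
    next
      case False
      then have *: "a / x \<in> V" using valuation_domainD(5)[OF V] by fastforce
      have "b / x \<in> V" if "b \<in> A" for b
        using valuation_domainD(4)[OF V a(2)[OF that] *] nz by simp
      then show ?thesis using valuation_domainD(1)[OF V] nz by auto
    qed
  qed
  then show thesis using that by blast
qed

section \<open>A topological criterion\<close>

text \<open>For spectra, the last clause says that the prime \<open>x\<close> contains the prime
  \<open>y\<close>; it is phrased by closures to be meaningful in any space. The set
  \<open>U\<close> plays the locus where a fraction \<open>z\<close> is regular, and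
  \<open>C\<close> the zero locus of a nonzero \<open>c\<close> with all \<open>c * z ^ n\<close> in
  D.\<close>

definition infinitesimal_pair :: "'x topology \<Rightarrow> 'x set \<Rightarrow> 'x set \<Rightarrow> bool" where
  "infinitesimal_pair \<tau> U C \<longleftrightarrow>
     openin \<tau> U \<and> compactin \<tau> U \<and> U \<noteq> topspace \<tau> \<and> closedin \<tau> C \<and> C \<noteq> topspace \<tau> \<and>
     (\<forall>x \<in> topspace \<tau> - U. \<exists>y \<in> U \<inter> C. x \<in> \<tau> closure_of {y})"

lemma infinitesimal_pair_homeomorphic_map:
  assumes f: "homeomorphic_map \<tau> \<sigma> f" and *: "infinitesimal_pair \<tau> U C"
  shows "infinitesimal_pair \<sigma> (f ` U) (f ` C)"
proof -
  have sub: "U \<subseteq> topspace \<tau>" "C \<subseteq> topspace \<tau>"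
    using * unfolding infinitesimal_pair_def by (simp_all add: openin_subset closedin_subset)
  have inj: "inj_on f (topspace \<tau>)" and im: "f ` topspace \<tau> = topspace \<sigma>"
    using f homeomorphic_imp_injective_map homeomorphic_imp_surjective_map by blast+
  have "\<exists>y \<in> f ` U \<inter> f ` C. x \<in> \<sigma> closure_of {y}" if "x \<in> topspace \<sigma> - f ` U" for x
  proof -
    have "x \<in> f ` topspace \<tau>" using that by (simp add: im)
    then obtain x' where x': "x' \<in> topspace \<tau>" "x = f x'" by blast
    then have "x' \<in> topspace \<tau> - U" using that by auto
    then obtain y where y: "y \<in> U" "y \<in> C" "x' \<in> \<tau> closure_of {y}"
      using * unfolding infinitesimal_pair_def by blast
    have "\<sigma> closure_of {f y} = f ` (\<tau> closure_of {y})"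
      using homeomorphic_map_closure_of[OF f, of "{y}"] sub(1) y(1) by auto
    then show ?thesis using y x'(2) by blast
  qed
  then show ?thesis
    using * sub inj im inj_on_image_eq_iff[OF inj]
      homeomorphic_map_openness_eq[OF f] homeomorphic_map_closedness_eq[OF f]
      homeomorphic_map_compactness_eq[OF f]
    unfolding infinitesimal_pair_def by (metis order_refl)
qed

section \<open>From an almost integral element outside the domain to an infinitesimal pair\<close>

lemma infinitesimal_pair_if_almost_integral:
  fixes z :: "'a::idom fract"
  assumes prufer: "prufer_domain TYPE('a)" and z: "almost_integral z" "z \<notin> range to_fract"
  shows "\<exists>U C. infinitesimal_pair (zariski_topology :: 'a set topology) U C"
proof -
  have val: "valuation_domain (localization P)" if "P \<in> spectrum" for P :: "'a set"
    using prufer that by (simp add: prufer_domain_def)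
  obtain c :: 'a where c: "c \<noteq> 0" "\<And>n. to_fract c * z ^ n \<in> range to_fract"
  proof -
    obtain c :: 'a where c: "c \<noteq> 0" "\<And>n. n \<ge> 1 \<Longrightarrow> to_fract c * z ^ n \<in> range to_fract"
      using z(1) by (auto simp: almost_integral_def)
    \<comment> \<open>Almost integrality starts at exponent 1; exponent 0 is added because the prime
      \<open>Q\<close> below quantifies over all \<open>n\<close>.\<close>
    have "to_fract c * z ^ n \<in> range to_fract" for n
      using c(2)[of n] by (cases n) auto
    with c(1) that show thesis by blast
  qed
  have z0: "z \<noteq> 0" using z(2) by (metis rangeI to_fract_0)
  define U where "U = {P \<in> spectrum. \<not> denominators z \<subseteq> P}"
  define C where "C = {P \<in> spectrum. c \<in> P}"
  have "compactin zariski_topology U"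
  proof -
    \<comment> \<open>A prime containing both conductors would have neither \<open>z\<close> nor its
      inverse in its localization.\<close>
    have "1 \<in> ring_ideal.span (denominators z \<union> denominators (inverse z))"
    proof (rule ccontr)
      assume "1 \<notin> ring_ideal.span (denominators z \<union> denominators (inverse z))"
      then obtain P where "P \<in> spectrum"
        "ring_ideal.span (denominators z \<union> denominators (inverse z)) \<subseteq> P"
        using prime_ideal_containing[OF ring_ideal.subspace_span] by blast
      then have "denominators z \<subseteq> P" "denominators (inverse z) \<subseteq> P"
        using ring_ideal.span_superset by blast+
      then show False
        using valuation_domainD(5)[OF val[OF \<open>P \<in> spectrum\<close>], of z]
          localization_iff_denominators[OF \<open>P \<in> spectrum\<close>] by blast
    qed
    then obtain s t where st: "s \<in> denominators z" "t \<in> denominators (inverse z)" "s + t = 1"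
      by (auto simp: ring_ideal.span_Un ring_ideal.span_eq_iff[THEN iffD2] denominators_subspace)
    \<comment> \<open>With \<open>u = t / z\<close>, the elements \<open>s\<close> and
      \<open>u\<close> generate \<open>denominators z\<close>: any \<open>d\<close> in it equals
      \<open>d * s + d * t\<close>, and \<open>d * t = (d * z) * u\<close>. Hence \<open>U\<close>
      is a union of two basic open sets.\<close>
    obtain u where u: "to_fract t * inverse z = to_fract u" using st(2) by (rule denominatorsE)
    then have t: "to_fract t = to_fract u * z" using z0 by (simp add: field_simps)
    have "u \<in> denominators z" by (auto simp: denominators_def simp flip: t)
    have "denominators z \<subseteq> P \<longleftrightarrow> s \<in> P \<and> u \<in> P" if P: "P \<in> spectrum" for P
    proof
      assume "s \<in> P \<and> u \<in> P"
      show "denominators z \<subseteq> P"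
      proof
        fix d assume "d \<in> denominators z"
        then obtain e where "to_fract d * z = to_fract e" by (rule denominatorsE)
        then have "to_fract (d * t) = to_fract (e * u)" by (simp add: t mult_ac)
        then have "d * t = e * u" by (simp only: to_fract_eq_iff)
        then have "d = d * s + e * u" using st(3) by (metis distrib_left mult.right_neutral)
        then show "d \<in> P"
          using \<open>s \<in> P \<and> u \<in> P\<close> prime_idealD[OF P] by metis
      qed
    qed (use st \<open>u \<in> denominators z\<close> in blast)
    then have "U = {P \<in> spectrum. s \<notin> P} \<union> {P \<in> spectrum. u \<notin> P}"
      unfolding U_def by blast
    then show ?thesis
      using compactin_Un[OF compactin_zariski_basic compactin_zariski_basic] by metis
  qed
  moreover have "openin zariski_topology U" by (simp add: U_def openin_zariski)
  moreover have "U \<noteq> topspace zariski_topology"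
  proof
    assume "U = topspace zariski_topology"
    then have "z \<in> localization P" if "P \<in> spectrum" for P
      using that by (auto simp: U_def topspace_zariski_topology localization_iff_denominators)
    then show False using in_range_to_fract_if_locally z(2) by blast
  qed
  moreover have "closedin zariski_topology C"
  proof -
    have "topspace zariski_topology - C = {P \<in> spectrum. \<not> {c} \<subseteq> P}"
      by (auto simp: C_def topspace_zariski_topology)
    then show ?thesis
      using openin_zariski[of "{c}"] by (auto simp: closedin_def C_def topspace_zariski_topology)
  qed
  moreover have "C \<noteq> topspace zariski_topology"
    using zero_in_spectrum c(1) by (force simp: C_def topspace_zariski_topology)
  moreover have "\<exists>Q \<in> U \<inter> C. M \<in> zariski_topology closure_of {Q}"
    if "M \<in> topspace zariski_topology - U" for M
  proof -
    have M: "M \<in> spectrum" and zM: "z \<notin> localization M"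
      using that localization_iff_denominators by (auto simp: U_def topspace_zariski_topology)
    note V = valuation_domainD[OF val[OF M]]
    \<comment> \<open>This is the contraction to D of the intersection of the powers of the
      principal ideal generated by 1/z in D_M.\<close>
    define Q where "Q = {d. \<forall>n. to_fract d * z ^ n \<in> localization M}"
    have "prime_ideal Q"
      unfolding prime_ideal_def
    proof (intro conjI allI ballI impI)
      show "0 \<in> Q" by (simp add: Q_def V)
      show "x + y \<in> Q" if "x \<in> Q" "y \<in> Q" for x y
        using that by (simp add: Q_def distrib_right V)
      show "r * x \<in> Q" if "x \<in> Q" for r x
        using that to_fract_in_localization[OF M] by (simp add: Q_def mult.assoc V)
      have "1 \<notin> Q" using zM by (auto simp: Q_def intro!: exI[of _ 1])
      then show "Q \<noteq> UNIV" by blast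
      fix a b assume ab: "a * b \<in> Q"
      show "a \<in> Q \<or> b \<in> Q"
      proof (rule ccontr)
        assume "\<not> (a \<in> Q \<or> b \<in> Q)"
        then obtain m n where a: "to_fract a * z ^ m \<notin> localization M"
          and b: "to_fract b * z ^ n \<notin> localization M" by (auto simp: Q_def)
        then have "a \<noteq> 0" "b \<noteq> 0" using V(2) by auto
        \<comment> \<open>In a valuation domain both inverses lie in D_M, and the exponent
          \<open>m + n + 1\<close> leaves exactly one factor \<open>z\<close>.\<close>
        then have "z = inverse (to_fract a * z ^ m) * inverse (to_fract b * z ^ n) *
            (to_fract (a * b) * z ^ (m + n + 1))"
          using z0 by (simp add: field_simps power_add)
        also have "\<dots> \<in> localization M"
          using ab V(5)[OF a] V(5)[OF b] unfolding Q_def by (blast intro: V(4))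
        finally show False using zM by contradiction
      qed
    qed
    then have Q: "Q \<in> spectrum" by (simp add: spectrum_def)
    have "Q \<subseteq> M"
    proof
      fix d assume "d \<in> Q"
      \<comment> \<open>Exponent 1 suffices: outside \<open>M\<close>, \<open>d\<close> would be a
        unit of D_M and \<open>z\<close> would lie in D_M.\<close>
      then have "to_fract d * z ^ 1 \<in> localization M" unfolding Q_def by blast
      then obtain a s where s: "s \<notin> M" "to_fract s * (to_fract d * z) = to_fract a"
        using localizationE[OF M, of "to_fract d * z"] by (metis power_one_right)
      show "d \<in> M"
      proof (rule ccontr)
        assume "d \<notin> M"
        then have "s * d \<notin> M" using s(1) by (simp add: prime_idealD[OF M])
        then show False using zM localizationI[OF M, of "s * d" z a] s(2) by (simp add: mult.assoc)
      qed
    qed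
    then have "M \<in> zariski_topology closure_of {Q}"
      by (simp add: closure_of_zariski_singleton M Q)
    moreover have "to_fract c * z ^ n \<in> localization M" for n
      using c(2)[of n] to_fract_in_localization[OF M] by (metis imageE)
    then have "c \<in> Q" by (simp add: Q_def)
    moreover have "\<not> denominators z \<subseteq> Q"
    proof
      assume sub: "denominators z \<subseteq> Q"
      \<comment> \<open>Writing 1/z as \<open>u / v\<close> makes \<open>u\<close> a denominator of
        \<open>z\<close>. If \<open>u\<close> were in \<open>Q\<close>, exponent 2 would put
        \<open>v * z\<close> in D_M, hence also \<open>z\<close>, since \<open>v\<close> is a unit
        there.\<close>
      obtain v u where v: "v \<notin> M" "to_fract v * inverse z = to_fract u"
        using localizationE[OF M V(5)[OF zM]] .
      then have uz: "to_fract u * z = to_fract v" using z0 by (auto simp: field_simps)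
      then have "u \<in> Q" using sub by (auto simp: denominators_def)
      then have "to_fract u * z ^ 2 \<in> localization M" unfolding Q_def by blast
      then have "to_fract v * z \<in> localization M"
        by (simp add: power2_eq_square flip: mult.assoc uz)
      then obtain a s where s: "s \<notin> M" "to_fract s * (to_fract v * z) = to_fract a"
        using localizationE[OF M] by metis
      moreover have "s * v \<notin> M" using s(1) v(1) by (simp add: prime_idealD[OF M])
      ultimately show False using zM localizationI[OF M, of "s * v" z a] by (simp add: mult.assoc)
    qed
    ultimately show ?thesis using Q by (auto simp: U_def C_def)
  qed
  ultimately show ?thesis unfolding infinitesimal_pair_def by blast
qed

section \<open>From an infinitesimal pair back to an almost integral element outside the
  domain\<close>

lemma almost_integral_if_infinitesimal_pair:
  assumes prufer: "prufer_domain TYPE('a::idom)"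
    and pair: "infinitesimal_pair (zariski_topology :: 'a set topology) U C"
  shows "\<exists>z :: 'a fract. almost_integral z \<and> z \<notin> range to_fract"
proof -
  have val: "valuation_domain (localization P)" if "P \<in> spectrum" for P :: "'a set"
    using prufer that by (simp add: prufer_domain_def)
  obtain T where T: "finite T" and U: "U = {P \<in> spectrum. \<not> T \<subseteq> P}"
    using pair compact_openin_zariskiE unfolding infinitesimal_pair_def by metis
  obtain c where c: "c \<noteq> 0" "\<And>Q. Q \<in> C \<Longrightarrow> c \<in> Q"
  proof -
    have "openin zariski_topology (spectrum - C)" and C: "C \<subseteq> spectrum" "C \<noteq> spectrum"
      using pair unfolding infinitesimal_pair_def closedin_def topspace_zariski_topology by auto
    then obtain F where F: "spectrum - C = {P \<in> spectrum. \<not> F \<subseteq> P}"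
      by (auto simp: openin_zariski_topology)
    \<comment> \<open>An element of \<open>F\<close> vanishes on all of \<open>C\<close>; one lying
      outside some prime is moreover nonzero.\<close>
    then obtain P c where "P \<in> spectrum" "c \<in> F" "c \<notin> P" using C by blast
    moreover have "c \<in> Q" if "Q \<in> C" for Q using F C(1) that \<open>c \<in> F\<close> by blast
    ultimately show thesis using that prime_idealD(1) by metis
  qed
  have below: "\<exists>Q \<in> spectrum. Q \<subseteq> N \<and> \<not> T \<subseteq> Q \<and> c \<in> Q" if "N \<in> spectrum" "T \<subseteq> N" for N
  proof -
    have "N \<in> topspace zariski_topology - U"
      using that by (simp add: U topspace_zariski_topology)
    then obtain Q where Q: "Q \<in> U" "Q \<in> C" "N \<in> zariski_topology closure_of {Q}"
      using pair unfolding infinitesimal_pair_def by blast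
    then have "Q \<subseteq> N" using closure_of_zariski_singleton[OF that(1)] by (simp add: U)
    with Q(1) c(2)[OF Q(2)] show ?thesis unfolding U by blast
  qed
  obtain M where M: "M \<in> spectrum" "T \<subseteq> M"
    using pair unfolding infinitesimal_pair_def topspace_zariski_topology U by blast
  \<comment> \<open>The prime below \<open>M\<close> contains 0 but not all of
    \<open>T\<close>.\<close>
  have "T - {0} \<noteq> {}" using below[OF M] prime_idealD(1) by blast
  then have "finite (to_fract ` (T - {0}))" "to_fract ` (T - {0}) \<noteq> {}"
    "0 \<notin> to_fract ` (T - {0})" using T by auto
  \<comment> \<open>The chosen element of \<open>T\<close> generates the extension of
    \<open>T\<close> to D_M.\<close>
  from valuation_domain_principal[OF val[OF M(1)] this]
  obtain a' where a': "a' \<in> to_fract ` (T - {0})"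
    "\<And>b. b \<in> to_fract ` (T - {0}) \<Longrightarrow> b / a' \<in> localization M" by metis
  then obtain a where a: "a \<in> T" "a \<noteq> 0" "a' = to_fract a" by blast
  have "to_fract b / to_fract a \<in> localization M" if "b \<in> T" for b
    using a'(2)[of "to_fract b"] a(3) that valuation_domainD(2)[OF val[OF M(1)]] by (cases "b = 0") auto
  then have "(\<lambda>b. to_fract b / to_fract a) ` T \<subseteq> localization M" by blast
  from common_denominator[OF M(1) finite_imageI[OF T] this]
  obtain s where s_notin: "s \<notin> M"
    and s: "\<And>x. x \<in> (\<lambda>b. to_fract b / to_fract a) ` T \<Longrightarrow> to_fract s * x \<in> range to_fract"
    by metis
  \<comment> \<open>Since \<open>s\<close> clears the denominators of all \<open>b / a\<close>,
    multiplication by \<open>z\<close> maps \<open>T\<close> into D. If \<open>z\<close> were in D,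
    \<open>s\<close> would be a multiple of \<open>a\<close>, hence in \<open>M\<close>.\<close>
  define z where "z = to_fract s / to_fract a"
  have zb: "to_fract b * z \<in> range to_fract" if "b \<in> T" for b
    using s[OF imageI[OF that]] by (simp add: z_def mult.commute)
  have "z \<notin> range to_fract"
  proof
    assume "z \<in> range to_fract"
    then obtain d where "z = to_fract d" by blast
    then have "to_fract s = to_fract (d * a)" using a(2) by (simp add: z_def field_simps)
    then have "s = d * a" by (simp only: to_fract_eq_iff)
    then show False using s_notin a(1) M by (auto simp: prime_idealD)
  qed
  moreover have zloc: "z \<in> localization N" if "N \<in> spectrum" "\<not> T \<subseteq> N" for N
    using that zb by (auto simp: localization_iff_denominators denominators_def)
  have "to_fract c * z ^ n \<in> range to_fract" for n
  proof (rule in_range_to_fract_if_locally)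
    fix N :: "'a set" assume N: "N \<in> spectrum"
    note V = valuation_domainD[OF val[OF N]]
    show "to_fract c * z ^ n \<in> localization N"
    proof (cases "T \<subseteq> N")
      case False
      then show ?thesis using zloc N to_fract_in_localization by (blast intro: V(4) V(6))
    next
      case True
      then obtain Q where Q: "Q \<in> spectrum" "Q \<subseteq> N" "\<not> T \<subseteq> Q" "c \<in> Q"
        using below N by blast
      have "z ^ n \<in> localization Q"
        using valuation_domainD(6)[OF val[OF Q(1)]] zloc Q by blast
      then obtain e d where e: "e \<notin> Q" "to_fract e * z ^ n = to_fract d"
        using localizationE[OF Q(1)] by blast
      show ?thesis
      proof (rule ccontr)
        assume w: "to_fract c * z ^ n \<notin> localization N"
        then have nz: "to_fract c * z ^ n \<noteq> 0" using V(2) by metis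
        \<comment> \<open>If the claim failed, the inverse would be \<open>u / v\<close> in D_N.
          Clearing denominators gives \<open>v * e = u * c * d\<close>, which is in \<open>Q\<close>
          because \<open>c\<close> is, although neither \<open>v\<close> nor \<open>e\<close> is in
          the prime \<open>Q\<close>.\<close>
        obtain v u where v: "v \<notin> N" "to_fract v * inverse (to_fract c * z ^ n) = to_fract u"
          using localizationE[OF N V(5)[OF w]] .
        then have "to_fract v = to_fract u * (to_fract c * z ^ n)"
          using nz by (auto simp: field_simps)
        then have "to_fract (v * e) = to_fract u * to_fract c * (to_fract e * z ^ n)"
          by (simp add: mult_ac)
        then have "to_fract (v * e) = to_fract (u * c * d)" by (simp add: e)
        then have "v * e = u * c * d" by (simp only: to_fract_eq_iff)
        then have "v * e \<in> Q" using Q by (simp add: prime_idealD)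
        then show False using v(1) e(1) Q prime_idealD(6) by blast
      qed
    qed
  qed
  then have "almost_integral z" using c(1) by (auto simp: almost_integral_def)
  ultimately show ?thesis by blast
qed

section \<open>Conclusion: the criterion and its transfer between homeomorphic spectra\<close>

lemma completely_integrally_closed_iff:
  "completely_integrally_closed TYPE('a::idom) \<longleftrightarrow>
     (\<forall>z :: 'a fract. almost_integral z \<longrightarrow> z \<in> range to_fract)"
proof -
  \<comment> \<open>The witness \<open>c = 1\<close> shows that D lies in its complete integral
    closure, so only the other inclusion matters.\<close>
  have "almost_integral (to_fract a)" for a :: 'a
    unfolding almost_integral_def
    by (intro exI[of _ 1]) (auto simp flip: to_fract_power)
  then show ?thesis
    by (auto simp: completely_integrally_closed_def complete_integral_closure_def)
qed

theorem completely_integrally_closed_iff_no_infinitesimal_pair: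
  assumes "prufer_domain TYPE('a::idom)"
  shows "completely_integrally_closed TYPE('a) \<longleftrightarrow>
    (\<nexists>U C. infinitesimal_pair (zariski_topology :: 'a set topology) U C)"
  using infinitesimal_pair_if_almost_integral[OF assms]
    almost_integral_if_infinitesimal_pair[OF assms]
  unfolding completely_integrally_closed_iff by blast

theorem corollary2p11:
  assumes "prufer_domain TYPE('a::idom)"
    and "prufer_domain TYPE('b::idom)"
    and "(zariski_topology :: 'a set topology) homeomorphic_space (zariski_topology :: 'b set topology)"
  shows "completely_integrally_closed TYPE('a) \<longleftrightarrow> completely_integrally_closed TYPE('b)"
proof -
  \<comment> \<open>Only the existence of a pair is transported, so one homeomorphism in each
    direction is enough; they need not be mutually inverse.\<close>
  obtain f g where "homeomorphic_map zariski_topology zariski_topology (f :: 'a set \<Rightarrow> 'b set)"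
    "homeomorphic_map zariski_topology zariski_topology (g :: 'b set \<Rightarrow> 'a set)"
    using assms(3) homeomorphic_space homeomorphic_space_sym by metis
  then show ?thesis
    using infinitesimal_pair_homeomorphic_map
    unfolding completely_integrally_closed_iff_no_infinitesimal_pair[OF assms(1)]
      completely_integrally_closed_iff_no_infinitesimal_pair[OF assms(2)]
    by metis
qed

end
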